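(* Let $(P,d)$ be a finite metric space with $P=H_1\cupdot\dots\cupdot H_m$, let $t_1,\dots,t_m\in\mathbb N$ be coprime positive integers with $|H_1|>0$ a multiple of $t_1$ and $|H_i|\ge\frac{t_i}{t_1}|H_1|$ for $2\le i\le m$, and $k\ge1$. Let $\mathrm{OPT}_{\mathrm{fair}}$ be the cost of an optimal $t_1:\dots:t_m$-fair $k$-center clustering with $|H_i|-\frac{t_i}{t_1}|H_1|$ outliers from $H_i$ ($2\le i\le m$). Then the algorithm \textsc{compute-$t_1:\dots:t_m$-fairlets} described in the context computes a $t_1:\dots:t_m$-fairlet decomposition $\mathcal F$ of $P$ with $|H_i|-\frac{t_i}{t_1}|H_1|$ outliers from $H_i$ for all $2\le i\le m$ (i.e. that many points of $H_i$ are not covered by $\mathcal F$) such that $\max_{p\in f}d(\mathrm{anc}(f),p)\le12\,\mathrm{OPT}_{\mathrm{fair}}$ for all $f\in\mathcal F$, where $\mathrm{anc}(f)$ is the anchor of $f$.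
   Context: A $t_1:\dots:t_m$-fairlet is a set $f\subseteq P$ with $|f\cap H_i|=t_i$ for all $i$; a fairlet decomposition is a maximal set of pairwise disjoint fairlets. A $t_1:\dots:t_m$-fair $k$-clustering with outliers is a set $C\subseteq P$ of at most $k$ centers and a map $\alpha:P\to C\cup\{\perp\}$ such that each cluster $Q=\alpha^{-1}(c)$ satisfies $t_1|Q\cap H_i|=t_i|Q\cap H_1|$ for all $i$; outliers are $\alpha^{-1}(\perp)$ (here $|H_i|-\frac{t_i}{t_1}|H_1|$ in $H_i$ for $i\ge2$, none in $H_1$). The cost is $\max_{\alpha(x)\ne\perp}d(x,\alpha(x))$. Capacitated multi-$\ell$-center on a point set $X$ with capacity $u$: find a multiset $A$ of at most $\ell$ centers from $X$ and an assignment $\kappa:X\to A$ such that each element (copy) of $A$ receives at most $u$ points, minimizing $\max_{p\in X}d(p,\kappa(p))$. A $5$-approximate solution has cost at most $5$ times the minimum. \textsc{compute-$1:t$-fairlets}$(P',d',R,B)$ with threshold factor $\tau$, for disjoint $R,B\subseteq P'$ and a pseudometric $d'$ on $P'$: let $D=\{d'(x,y):x,y\in P'\}$, sorted increasingly. For $\delta\in D$ in this order build the flow network with vertices $B\cup R\cup\{v,w\}$, source $v$, sink $w$, edges $(v,b)$ of capacity $1$ ($b\in B$), edges $(b,r)$ of capacity $1$ ($b\in B,r\in R$, $d'(b,r)\le\tau\delta$), edges $(r,w)$ of capacity $t$ ($r\in R$); compute a maximum integral flow $\mathbf f$. At the first $\delta$ with $|\mathbf f|=t|R|$ return $\{f_r:r\in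 R\}$, $f_r=\{r\}\cup\{b\in B:\mathbf f(b,r)=1\}$. \textsc{compute-$t_1:\dots:t_m$-fairlets}: (1) Let $(A,\kappa)$ be a $5$-approximate solution of capacitated multi-$\ell$-center on $X=H_1$ with $\ell=|H_1|/t_1$ and capacity $t_1$. (2) Let $P'=A\cupdot H_1\cupdot\dots\cupdot H_m$, where the elements of $A$ are treated as new (copied) points forming an additional color class, and let $d'$ be the pseudometric on $P'$ giving the distance in $d$ of the underlying original points. For each $i=1,\dots,m$ let $\mathcal F_i$ be the output of \textsc{compute-$1:t_i$-fairlets}$(P',d',A,H_i)$ with $\tau=12$. For each $a\in A$ let $f'_a$ be the union over $i$ of the fairlets of $\mathcal F_i$ containing $a$. (3) Return $\mathcal F=\{f'_a\setminus A: a\in A\}$ with anchor of $f'_a\setminus A$ equal to $a$ (i.e. the original point underlying $a$). *)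

theory Defs
  imports "HOL-Analysis.Analysis"
begin

text \<open>
  A point set \<open>P\<close> is partitioned into colour classes \<open>H 1, \<dots>, H m\<close>; the ratio
  is given by \<open>t 1, \<dots>, t m\<close>. Values of \<open>H\<close> and \<open>t\<close> outside \<open>{1..m}\<close> are irrelevant.
\<close>

section \<open>Fairlets and fair clusterings with outliers\<close>

definition fairlet :: "'a set \<Rightarrow> (nat \<Rightarrow> 'a set) \<Rightarrow> (nat \<Rightarrow> nat) \<Rightarrow> nat \<Rightarrow> 'a set \<Rightarrow> bool" where
  "fairlet P H t m f \<longleftrightarrow> f \<subseteq> P \<and> (\<forall>i\<in>{1..m}. card (f \<inter> H i) = t i)"

text \<open>Maximality is with respect to inclusion.\<close>

definition fairlet_decomposition ::
    "'a set \<Rightarrow> (nat \<Rightarrow> 'a set) \<Rightarrow> (nat \<Rightarrow> nat) \<Rightarrow> nat \<Rightarrow> 'a set set \<Rightarrow> bool" where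
  "fairlet_decomposition P H t m F \<longleftrightarrow>
     (\<forall>f\<in>F. fairlet P H t m f) \<and> disjoint F \<and>
     \<not> (\<exists>F'. F \<subset> F' \<and> (\<forall>f\<in>F'. fairlet P H t m f) \<and> disjoint F')"

definition num_outliers :: "(nat \<Rightarrow> 'a set) \<Rightarrow> (nat \<Rightarrow> nat) \<Rightarrow> nat \<Rightarrow> real" where
  "num_outliers H t i = real (card (H i)) - real (t i) / real (t 1) * real (card (H 1))"

text \<open>
  The value \<open>None\<close> of the assignment \<open>\<alpha>\<close> plays the role of \<open>\<bottom>\<close>. For \<open>i = 1\<close> the last
  condition says that no point of \<open>H 1\<close> is an outlier.
\<close>

definition fair_clustering ::
    "'a set \<Rightarrow> (nat \<Rightarrow> 'a set) \<Rightarrow> (nat \<Rightarrow> nat) \<Rightarrow> nat \<Rightarrow> nat \<Rightarrow> 'a set \<Rightarrow> ('a \<Rightarrow> 'a option) \<Rightarrow> bool" where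
  "fair_clustering P H t m k C \<alpha> \<longleftrightarrow>
     C \<subseteq> P \<and> card C \<le> k \<and>
     (\<forall>x\<in>P. \<alpha> x \<in> insert None (Some ` C)) \<and>
     (\<forall>c\<in>C. let Q = {x\<in>P. \<alpha> x = Some c}
             in \<forall>i\<in>{1..m}. t 1 * card (Q \<inter> H i) = t i * card (Q \<inter> H 1)) \<and>
     (\<forall>i\<in>{1..m}. real (card {x\<in>H i. \<alpha> x = None}) = num_outliers H t i)"

definition clustering_cost :: "'a set \<Rightarrow> ('a \<Rightarrow> 'a \<Rightarrow> real) \<Rightarrow> ('a \<Rightarrow> 'a option) \<Rightarrow> real" where
  "clustering_cost P d \<alpha> = Max {d x c |x c. x \<in> P \<and> \<alpha> x = Some c}"

definition OPT_fair ::
    "'a set \<Rightarrow> ('a \<Rightarrow> 'a \<Rightarrow> real) \<Rightarrow> (nat \<Rightarrow> 'a set) \<Rightarrow> (nat \<Rightarrow> nat) \<Rightarrow> nat \<Rightarrow> nat \<Rightarrow> real" where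
  "OPT_fair P d H t m k = Min {clustering_cost P d \<alpha> |C \<alpha>. fair_clustering P H t m k C \<alpha>}"

section \<open>Capacitated multi-center\<close>

text \<open>The pair \<open>(a, j)\<close> is the \<open>j\<close>-th copy of \<open>a\<close> in the multiset \<open>A\<close>.\<close>

definition copies :: "'a multiset \<Rightarrow> ('a \<times> nat) set" where
  "copies A = {(a, j). j < count A a}"

definition cap_center_solution ::
    "'a set \<Rightarrow> nat \<Rightarrow> nat \<Rightarrow> 'a multiset \<Rightarrow> ('a \<Rightarrow> 'a \<times> nat) \<Rightarrow> bool" where
  "cap_center_solution X l u A \<kappa> \<longleftrightarrow>
     set_mset A \<subseteq> X \<and> size A \<le> l \<and> \<kappa> ` X \<subseteq> copies A \<and>
     (\<forall>c\<in>copies A. card {p\<in>X. \<kappa> p = c} \<le> u)"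

definition cap_center_cost ::
    "'a set \<Rightarrow> ('a \<Rightarrow> 'a \<Rightarrow> real) \<Rightarrow> ('a \<Rightarrow> 'a \<times> nat) \<Rightarrow> real" where
  "cap_center_cost X d \<kappa> = Max ((\<lambda>p. d p (fst (\<kappa> p))) ` X)"

definition cap_center_opt :: "'a set \<Rightarrow> ('a \<Rightarrow> 'a \<Rightarrow> real) \<Rightarrow> nat \<Rightarrow> nat \<Rightarrow> real" where
  "cap_center_opt X d l u = Min {cap_center_cost X d \<kappa> |A \<kappa>. cap_center_solution X l u A \<kappa>}"

definition cap_center_approx ::
    "real \<Rightarrow> 'a set \<Rightarrow> ('a \<Rightarrow> 'a \<Rightarrow> real) \<Rightarrow> nat \<Rightarrow> nat \<Rightarrow> 'a multiset \<Rightarrow> ('a \<Rightarrow> 'a \<times> nat) \<Rightarrow> bool" where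
  "cap_center_approx c X d l u A \<kappa> \<longleftrightarrow>
     cap_center_solution X l u A \<kappa> \<and> cap_center_cost X d \<kappa> \<le> c * cap_center_opt X d l u"

section \<open>Integral flows\<close>

record 'v network =
  nw_verts :: "'v set"
  nw_edges :: "('v \<times> 'v) set"
  nw_cap :: "'v \<times> 'v \<Rightarrow> int"
  nw_source :: 'v
  nw_sink :: 'v

definition integral_flow :: "'v network \<Rightarrow> ('v \<times> 'v \<Rightarrow> int) \<Rightarrow> bool" where
  "integral_flow N f \<longleftrightarrow>
     (\<forall>e\<in>nw_edges N. 0 \<le> f e \<and> f e \<le> nw_cap N e) \<and>
     (\<forall>e. e \<notin> nw_edges N \<longrightarrow> f e = 0) \<and>
     (\<forall>x\<in>nw_verts N - {nw_source N, nw_sink N}.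
        (\<Sum>e\<in>{e\<in>nw_edges N. snd e = x}. f e) = (\<Sum>e\<in>{e\<in>nw_edges N. fst e = x}. f e))"

definition flow_value :: "'v network \<Rightarrow> ('v \<times> 'v \<Rightarrow> int) \<Rightarrow> int" where
  "flow_value N f =
     (\<Sum>e\<in>{e\<in>nw_edges N. fst e = nw_source N}. f e) -
     (\<Sum>e\<in>{e\<in>nw_edges N. snd e = nw_source N}. f e)"

definition max_integral_flow :: "'v network \<Rightarrow> ('v \<times> 'v \<Rightarrow> int) \<Rightarrow> bool" where
  "max_integral_flow N f \<longleftrightarrow>
     integral_flow N f \<and> (\<forall>g. integral_flow N g \<longrightarrow> flow_value N g \<le> flow_value N f)"

section \<open>The two fairlet algorithms\<close>

datatype 'p vertex = Source | Sink | Point 'p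

definition fairlet_network ::
    "('p \<Rightarrow> 'p \<Rightarrow> real) \<Rightarrow> 'p set \<Rightarrow> 'p set \<Rightarrow> nat \<Rightarrow> real \<Rightarrow> real \<Rightarrow> 'p vertex network" where
  "fairlet_network d' R B t \<tau> \<delta> =
     \<lparr> nw_verts = Point ` (B \<union> R) \<union> {Source, Sink},
       nw_edges = {(Source, Point b) |b. b \<in> B} \<union>
                  {(Point b, Point r) |b r. b \<in> B \<and> r \<in> R \<and> d' b r \<le> \<tau> * \<delta>} \<union>
                  {(Point r, Sink) |r. r \<in> R},
       nw_cap = (\<lambda>(x, y). if y = Sink then int t else 1),
       nw_source = Source,
       nw_sink = Sink \<rparr>"

text \<open>
  The algorithms are nondeterministic (choice of the maximum flows and of the approximate
  solution), so they are modelled by the relation between input and possible result. The result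
  \<open>None\<close> stands for a run in which no threshold is successful.

  Here \<open>\<phi> \<delta>\<close> is the maximum flow computed for the threshold \<open>\<delta>\<close>.
\<close>

definition compute_1t_fairlets ::
    "'p set \<Rightarrow> ('p \<Rightarrow> 'p \<Rightarrow> real) \<Rightarrow> 'p set \<Rightarrow> 'p set \<Rightarrow> nat \<Rightarrow> real \<Rightarrow> 'p set set option \<Rightarrow> bool" where
  "compute_1t_fairlets P' d' R B t \<tau> res \<longleftrightarrow>
     (let D = {d' x y |x y. x \<in> P' \<and> y \<in> P'}; N = fairlet_network d' R B t \<tau> in
      \<exists>\<phi>. (\<forall>\<delta>\<in>D. max_integral_flow (N \<delta>) (\<phi> \<delta>)) \<and>
          res = map_option
                  (\<lambda>\<delta>. {insert r {b\<in>B. \<phi> \<delta> (Point b, Point r) = 1} |r. r \<in> R})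
                  (find (\<lambda>\<delta>. flow_value (N \<delta>) (\<phi> \<delta>) = int t * int (card R))
                        (sorted_list_of_set D)))"

text \<open>
  The set \<open>A \<union> H 1 \<union> \<dots> \<union> H m\<close> with copied centers is modelled in a sum type: \<open>Inl (a, j)\<close> is the
  point added for the copy \<open>(a, j)\<close> of \<open>a\<close>, and \<open>Inr p\<close> is the original point \<open>p\<close>.
\<close>

fun underlying :: "('a \<times> nat) + 'a \<Rightarrow> 'a" where
  "underlying (Inl (a, j)) = a"
| "underlying (Inr p) = p"

text \<open>
  A result is a set of pairs consisting of a fairlet and its anchor. In the definition, \<open>Fs i\<close> is
  the result for the colour \<open>i\<close> and \<open>f' c\<close> the union of all fairlets containing the copy \<open>c\<close>; the
  preimage under \<open>Inr\<close> turns \<open>f' c - A'\<close> back into a subset of the original point set.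
\<close>

definition compute_fairlets ::
    "('a \<Rightarrow> 'a \<Rightarrow> real) \<Rightarrow> (nat \<Rightarrow> 'a set) \<Rightarrow> (nat \<Rightarrow> nat) \<Rightarrow> nat \<Rightarrow> ('a set \<times> 'a) set option \<Rightarrow> bool" where
  "compute_fairlets d H t m res \<longleftrightarrow>
     (\<exists>A \<kappa> Fs.
        cap_center_approx 5 (H 1) d (card (H 1) div t 1) (t 1) A \<kappa> \<and>
        (let A' = Inl ` copies A;
             P' = A' \<union> (\<Union>i\<in>{1..m}. Inr ` H i);
             d' = (\<lambda>x y. d (underlying x) (underlying y));
             f' = (\<lambda>c. \<Union>i\<in>{1..m}. \<Union>{f \<in> the (Fs i). c \<in> f})
         in (\<forall>i\<in>{1..m}. compute_1t_fairlets P' d' A' (Inr ` H i) (t i) 12 (Fs i)) \<and>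
            res = (if \<exists>i\<in>{1..m}. Fs i = None then None
                   else Some {(Inr -` (f' c - A'), underlying c) |c. c \<in> A'})))"

end

(* Let S be a set of center copies. The points of H 1 served by S number t 1 * |S|, and
   the optimal clusters Q containing them satisfy t 1 * |Q \<inter> H i| = t i * |Q \<inter> H 1|, hence contain at
   least t i * |S| points of H i. Coprimality makes |Q \<inter> H 1| a multiple of t 1, so choosing in each Q
   a point of H 1 as center with multiplicity |Q \<inter> H 1| / t 1 costs at most 2 OPT, and the
   5-approximation costs at most 10 OPT. Going from a point of H i to the center of its cluster, to a
   point of H 1 in the cluster and to the copy serving it costs at most OPT + OPT + 10 OPT. So
   Hall's condition holds at the threshold OPT, which is a distance of the instance, and the flow
   for OPT saturates all center copies. *)

theory Submission
  imports Defs
begin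

text \<open>The obstacle is that saturating flows must exist although the approximate solution knows
  nothing of the other colours or of the optimal clusters. Counting overcomes it: since |H 1| = L *
  t 1, a capacitated solution with at most L copies of capacity t 1 has no slack, so there are
  exactly L copies and each serves exactly t 1 points. No point of H 1 is an outlier, so all points
  served lie in optimal clusters. The points of H 1 are rematched by a flow like every other colour;
  \<kappa> is the witness in Hall's condition, and the fairlets come from the flows. Each colour has
  its own flow and its own threshold, but all flows use the same copies, along which the parts are
  glued. The search may stop below OPT, with a flow unrelated to the one built from Hall's theorem.
  This is harmless: a value of t * |R| alone forces every copy to receive t points of its own, and a
  smaller threshold only admits shorter edges. Maximality holds because the L fairlets use up H 1,
  which every fairlet meets.\<close>

section \<open>Systems of distinct representatives\<close>

text \<open>Induction on the size of \<open>I\<close>, following Halmos and Vaughan. If some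
  nonempty proper \<open>J\<close> has exactly \<open>card J\<close> neighbours, it is matched
  first; deleting its neighbours keeps Hall's condition on \<open>I - J\<close>, because the
  condition for \<open>K \<union> J\<close> leaves enough other neighbours for \<open>K\<close>.
  Otherwise every nonempty proper subset has a neighbour to spare, so one element may take an
  arbitrary neighbour.\<close>

lemma hall_marriage:
  assumes "finite I" and "\<And>i. i \<in> I \<Longrightarrow> finite (N i)"
    and "\<And>J. J \<subseteq> I \<Longrightarrow> card J \<le> card (\<Union>(N ` J))"
  shows "\<exists>f. inj_on f I \<and> (\<forall>i\<in>I. f i \<in> N i)"
  using assms
proof (induction "card I" arbitrary: I N rule: less_induct)
  case less
  note fin = less.prems(1) and finN = less.prems(2) and hall = less.prems(3)
  have finU: "finite (\<Union>(N ` J))" if "J \<subseteq> I" for J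
    using that fin finN by (meson finite_UN_I finite_subset subsetD)
  consider (empty) "I = {}"
    | (tight) J where "J \<noteq> {}" "J \<subset> I" "card (\<Union>(N ` J)) = card J"
    | (slack) "I \<noteq> {}" "\<And>J. J \<noteq> {} \<Longrightarrow> J \<subset> I \<Longrightarrow> card (\<Union>(N ` J)) \<noteq> card J"
    by blast
  then show ?case
  proof cases
    case empty
    then show ?thesis by simp
  next
    case (tight J)
    have finJ: "finite J" using tight(2) fin finite_subset by blast
    have "card J < card I" using tight(2) fin by (simp add: psubset_card_mono)
    then have "\<exists>f. inj_on f J \<and> (\<forall>i\<in>J. f i \<in> N i)"
      by (rule less.hyps) (use tight(2) finJ finN hall in \<open>auto dest: psubset_imp_subset\<close>)
    then obtain f where f: "inj_on f J" "\<forall>i\<in>J. f i \<in> N i" by blast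
    let ?N = "\<lambda>i. N i - \<Union>(N ` J)"
    have "card (I - J) < card I"
      using tight(1,2) fin by (intro psubset_card_mono) auto
    then have "\<exists>g. inj_on g (I - J) \<and> (\<forall>i\<in>I - J. g i \<in> ?N i)"
    proof (rule less.hyps)
      fix K assume K: "K \<subseteq> I - J"
      have finK: "finite K" using K fin by (meson finite_Diff finite_subset)
      have "card K + card J = card (K \<union> J)"
        using K finK finJ by (subst card_Un_disjoint) auto
      also have "\<dots> \<le> card (\<Union>(N ` (K \<union> J)))"
        using K tight(2) by (intro hall) auto
      also have "\<Union>(N ` (K \<union> J)) = \<Union>(?N ` K) \<union> \<Union>(N ` J)" by auto
      also have "card \<dots> \<le> card (\<Union>(?N ` K)) + card (\<Union>(N ` J))" by (rule card_Un_le)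
      finally show "card K \<le> card (\<Union>(?N ` K))" using tight(3) by simp
    qed (use fin finN in auto)
    then obtain g where g: "inj_on g (I - J)" "\<forall>i\<in>I - J. g i \<in> ?N i" by blast
    let ?h = "\<lambda>i. if i \<in> J then f i else g i"
    have "f ` J \<subseteq> \<Union>(N ` J)" using f(2) by auto
    moreover have "g ` (I - J) \<inter> \<Union>(N ` J) = {}" using g(2) by auto
    ultimately have "f ` J \<inter> g ` (I - J) = {}" by blast
    from inj_on_disjoint_Un[OF f(1) g(1) this] have "inj_on ?h (J \<union> (I - J))" .
    then have "inj_on ?h I" using tight(2) by (simp add: Un_absorb1 psubset_imp_subset)
    moreover have "\<forall>i\<in>I. ?h i \<in> N i" using f g by auto
    ultimately show ?thesis by blast
  next
    case slack
    then obtain i where i: "i \<in> I" by blast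
    have "card {i} \<le> card (\<Union>(N ` {i}))" by (rule hall) (use i in auto)
    then obtain y where y: "y \<in> N i" by fastforce
    let ?N = "\<lambda>j. N j - {y}"
    have "card (I - {i}) < card I" using i fin by (meson card_Diff1_less)
    then have "\<exists>g. inj_on g (I - {i}) \<and> (\<forall>j\<in>I - {i}. g j \<in> ?N j)"
    proof (rule less.hyps)
      fix K assume K: "K \<subseteq> I - {i}"
      show "card K \<le> card (\<Union>(?N ` K))"
      proof (cases "K = {}")
        case False
        have "card (\<Union>(N ` K)) \<noteq> card K" using False K i by (intro slack(2)) auto
        moreover have "card K \<le> card (\<Union>(N ` K))" using K by (intro hall) auto
        ultimately have "card K \<le> card (\<Union>(N ` K)) - 1" by simp
        also have "\<dots> \<le> card (\<Union>(N ` K) - {y})"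
          using diff_card_le_card_Diff[of "{y}" "\<Union>(N ` K)"] by simp
        also have "\<Union>(N ` K) - {y} = \<Union>(?N ` K)" by auto
        finally show ?thesis .
      qed simp
    qed (use fin finN in auto)
    then obtain g where g: "inj_on g (I - {i})" "\<forall>j\<in>I - {i}. g j \<in> ?N j" by blast
    have "inj_on (g(i := y)) I"
      using g by (auto simp: inj_on_def)
    moreover have "\<forall>j\<in>I. (g(i := y)) j \<in> N j" using g y by auto
    ultimately show ?thesis by blast
  qed
qed

text \<open>Each \<open>r\<close> is split into \<open>t\<close> slots with the same neighbours. A
  set of slots over \<open>S\<close> has at most \<open>t * card S\<close> elements, so the weighted
  condition on \<open>R\<close> is Hall's condition on the slots.\<close>

lemma hall_capacitated:
  assumes "finite R" and "\<And>r. r \<in> R \<Longrightarrow> finite (N r)"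
    and "\<And>S. S \<subseteq> R \<Longrightarrow> t * card S \<le> card (\<Union>(N ` S))"
  shows "\<exists>M. disjoint_family_on M R \<and> (\<forall>r\<in>R. M r \<subseteq> N r \<and> card (M r) = t)"
proof -
  have "\<exists>f. inj_on f (R \<times> {..<t}) \<and> (\<forall>z\<in>R \<times> {..<t}. f z \<in> N (fst z))"
  proof (rule hall_marriage)
    fix J assume J: "J \<subseteq> R \<times> {..<t}"
    have "finite (fst ` J)" using J assms(1) by (meson finite_SigmaI finite_lessThan finite_imageI finite_subset)
    then have "card J \<le> card (fst ` J \<times> {..<t})" using J by (intro card_mono) force+
    also have "\<dots> = t * card (fst ` J)" by (simp add: card_cartesian_product)
    also have "\<dots> \<le> card (\<Union>(N ` (fst ` J)))" using J by (intro assms(3)) auto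
    finally show "card J \<le> card (\<Union>z\<in>J. N (fst z))" by (simp add: image_image)
  qed (use assms in auto)
  then obtain f where f: "inj_on f (R \<times> {..<t})" "\<forall>z\<in>R \<times> {..<t}. f z \<in> N (fst z)" by blast
  let ?M = "\<lambda>r. f ` ({r} \<times> {..<t})"
  have "card (?M r) = t" if "r \<in> R" for r
  proof -
    have "inj_on f ({r} \<times> {..<t})" using f(1) that by (auto intro: inj_on_subset)
    then show ?thesis by (simp add: card_image card_cartesian_product)
  qed
  moreover have "disjoint_family_on ?M R"
    unfolding disjoint_family_on_def using f(1) by (fastforce dest: inj_onD)
  moreover have "\<forall>r\<in>R. ?M r \<subseteq> N r" using f(2) by auto
  ultimately show ?thesis by (intro exI[of _ ?M]) blast
qed

section \<open>Flows in the fairlet network\<close>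

text \<open>Disjointness of \<open>R\<close> and \<open>B\<close> keeps the two middle layers of the
  network apart: no vertex \<open>Point x\<close> is both a point to be matched and a center
  copy.\<close>

locale fairlet_net =
  fixes d' :: "'p \<Rightarrow> 'p \<Rightarrow> real" and R B :: "'p set" and t :: nat and \<tau> \<delta> :: real
  assumes finR: "finite R" and finB: "finite B" and disj: "R \<inter> B = {}"
begin

abbreviation "N \<equiv> fairlet_network d' R B t \<tau> \<delta>"

lemma edges_eq: "nw_edges N = {(Source, Point b) |b. b \<in> B} \<union>
    {(Point b, Point r) |b r. b \<in> B \<and> r \<in> R \<and> d' b r \<le> \<tau> * \<delta>} \<union> {(Point r, Sink) |r. r \<in> R}"
  by (simp add: fairlet_network_def)

text \<open>As \<open>f\<close> vanishes off the edges, the sum may run over all of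
  \<open>B\<close>; later computations then need not know which pairs lie within the
  threshold.\<close>

lemma sum_into_center:
  assumes "\<And>e. e \<notin> nw_edges N \<Longrightarrow> f e = 0" and "r \<in> R"
  shows "(\<Sum>e\<in>{e\<in>nw_edges N. snd e = Point r}. f e) = (\<Sum>b\<in>B. f (Point b, Point r) :: int)"
proof -
  have "(\<Sum>e\<in>{e\<in>nw_edges N. snd e = Point r}. f e) = (\<Sum>e\<in>(\<lambda>b. (Point b, Point r)) ` B. f e)"
    using assms disj finB by (intro sum.mono_neutral_left) (auto simp: edges_eq)
  also have "\<dots> = (\<Sum>b\<in>B. f (Point b, Point r))"
    by (subst sum.reindex) (auto simp: inj_on_def)
  finally show ?thesis .
qed

lemma sum_out_of_center:
  assumes "r \<in> R"
  shows "(\<Sum>e\<in>{e\<in>nw_edges N. fst e = Point r}. f e) = (f (Point r, Sink) :: int)"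
proof -
  have "{e\<in>nw_edges N. fst e = Point r} = {(Point r, Sink)}"
    using assms disj by (auto simp: edges_eq)
  then show ?thesis by simp
qed

lemma sum_into_point:
  assumes "b \<in> B"
  shows "(\<Sum>e\<in>{e\<in>nw_edges N. snd e = Point b}. f e) = (f (Source, Point b) :: int)"
proof -
  have "{e\<in>nw_edges N. snd e = Point b} = {(Source, Point b)}"
    using assms disj by (auto simp: edges_eq)
  then show ?thesis by simp
qed

lemma sum_out_of_point:
  assumes "\<And>e. e \<notin> nw_edges N \<Longrightarrow> f e = 0" and "b \<in> B"
  shows "(\<Sum>e\<in>{e\<in>nw_edges N. fst e = Point b}. f e) = (\<Sum>r\<in>R. f (Point b, Point r) :: int)"
proof -
  have "(\<Sum>e\<in>{e\<in>nw_edges N. fst e = Point b}. f e) = (\<Sum>e\<in>(\<lambda>r. (Point b, Point r)) ` R. f e)"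
    using assms disj finR by (intro sum.mono_neutral_left) (auto simp: edges_eq)
  also have "\<dots> = (\<Sum>r\<in>R. f (Point b, Point r))"
    by (subst sum.reindex) (auto simp: inj_on_def)
  finally show ?thesis .
qed

lemma flow_value_eq: "flow_value N f = (\<Sum>b\<in>B. f (Source, Point b))"
proof -
  have out: "{e\<in>nw_edges N. fst e = Source} = (\<lambda>b. (Source, Point b)) ` B"
    and into: "{e\<in>nw_edges N. snd e = Source} = {}"
    by (auto simp: edges_eq)
  have "nw_source N = Source" by (simp add: fairlet_network_def)
  then show ?thesis
    unfolding flow_value_def by (simp only: out into) (simp add: sum.reindex inj_on_def)
qed

lemma integral_flow_iff:
  "integral_flow N f \<longleftrightarrow>
     (\<forall>e\<in>nw_edges N. 0 \<le> f e \<and> f e \<le> nw_cap N e) \<and>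
     (\<forall>e. e \<notin> nw_edges N \<longrightarrow> f e = 0) \<and>
     (\<forall>b\<in>B. f (Source, Point b) = (\<Sum>r\<in>R. f (Point b, Point r))) \<and>
     (\<forall>r\<in>R. f (Point r, Sink) = (\<Sum>b\<in>B. f (Point b, Point r)))"
proof -
  have V: "nw_verts N - {nw_source N, nw_sink N} = Point ` B \<union> Point ` R"
    by (auto simp: fairlet_network_def)
  have "(\<forall>x\<in>nw_verts N - {nw_source N, nw_sink N}.
        (\<Sum>e\<in>{e\<in>nw_edges N. snd e = x}. f e) = (\<Sum>e\<in>{e\<in>nw_edges N. fst e = x}. f e)) \<longleftrightarrow>
      (\<forall>b\<in>B. f (Source, Point b) = (\<Sum>r\<in>R. f (Point b, Point r))) \<and>
      (\<forall>r\<in>R. f (Point r, Sink) = (\<Sum>b\<in>B. f (Point b, Point r)))"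
    if supp: "\<And>e. e \<notin> nw_edges N \<Longrightarrow> f e = 0"
    unfolding V ball_Un ball_simps
    using sum_into_center[of f, OF supp] sum_out_of_center[of _ f]
      sum_into_point[of _ f] sum_out_of_point[of f, OF supp]
    by (metis (no_types, lifting))
  then show ?thesis unfolding integral_flow_def by blast
qed

lemma flow_bounds:
  assumes "integral_flow N f"
  shows "0 \<le> f (Point b, Point r)" "f (Point b, Point r) \<le> 1"
    "b \<in> B \<Longrightarrow> f (Source, Point b) \<le> 1" "r \<in> R \<Longrightarrow> f (Point r, Sink) \<le> int t"
    "f (Point b, Point r) \<noteq> 0 \<Longrightarrow> d' b r \<le> \<tau> * \<delta>"
proof -
  have 1: "0 \<le> f e" "f e \<le> nw_cap N e" if "e \<in> nw_edges N" for e
    using assms that by (auto simp: integral_flow_def)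
  have 2: "f e = 0" if "e \<notin> nw_edges N" for e
    using assms that unfolding integral_flow_def by blast
  have cap: "nw_cap N (x, y) = (if y = Sink then int t else 1)" for x y
    by (simp add: fairlet_network_def)
  show "0 \<le> f (Point b, Point r)" "f (Point b, Point r) \<le> 1"
    using 1[of "(Point b, Point r)"] 2[of "(Point b, Point r)"]
    by (cases "(Point b, Point r) \<in> nw_edges N"; simp add: cap)+
  show "f (Source, Point b) \<le> 1" if "b \<in> B"
    using 1(2)[of "(Source, Point b)"] that by (simp add: cap edges_eq)
  show "f (Point r, Sink) \<le> int t" if "r \<in> R"
    using 1(2)[of "(Point r, Sink)"] that by (simp add: cap edges_eq)
  show "d' b r \<le> \<tau> * \<delta>" if "f (Point b, Point r) \<noteq> 0"
    using 2[of "(Point b, Point r)"] that by (auto simp: edges_eq)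
qed

lemma flow_value_centers:
  assumes "integral_flow N f"
  shows "flow_value N f = (\<Sum>r\<in>R. f (Point r, Sink))"
proof -
  have "flow_value N f = (\<Sum>b\<in>B. \<Sum>r\<in>R. f (Point b, Point r))"
    using assms by (simp add: flow_value_eq integral_flow_iff)
  also have "\<dots> = (\<Sum>r\<in>R. \<Sum>b\<in>B. f (Point b, Point r))" by (rule sum.swap)
  also have "\<dots> = (\<Sum>r\<in>R. f (Point r, Sink))"
    using assms by (simp add: integral_flow_iff)
  finally show ?thesis .
qed

text \<open>The bound is the capacity of the cut around the sink. The success test of the algorithm
  asks for equality, that is, for a saturated cut.\<close>

lemma flow_value_le:
  assumes "integral_flow N f"
  shows "flow_value N f \<le> int t * int (card R)"
proof -
  have "(\<Sum>r\<in>R. f (Point r, Sink)) \<le> (\<Sum>r\<in>R. int t)"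
    by (intro sum_mono flow_bounds assms)
  then show ?thesis using assms by (simp add: flow_value_centers mult.commute)
qed

text \<open>Needed for a run of the algorithm to exist. The values are integers between 0 and the
  sink cut, so passing to \<open>nat\<close> allows the choice of a greatest one.\<close>

lemma max_integral_flow_exists: "\<exists>f. max_integral_flow N f"
proof -
  have "integral_flow N (\<lambda>_. 0)"
    by (auto simp: integral_flow_def fairlet_network_def)
  then have "\<exists>f. integral_flow N f \<and>
      (\<forall>g. integral_flow N g \<longrightarrow> nat (flow_value N g) \<le> nat (flow_value N f))"
    using flow_value_le nat_mono
    by (intro ex_has_greatest_nat[where b = "nat (int t * int (card R)) + 1"]) fastforce+
  then obtain f where f: "integral_flow N f"
    "\<And>g. integral_flow N g \<Longrightarrow> nat (flow_value N g) \<le> nat (flow_value N f)" by blast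
  have "0 \<le> flow_value N g" if "integral_flow N g" for g
    using that by (simp add: flow_value_eq integral_flow_iff sum_nonneg flow_bounds)
  then have "flow_value N g \<le> flow_value N f" if "integral_flow N g" for g
    using f that by (meson nat_le_eq_zle nat_le_iff order_trans le_nat_iff)
  then show ?thesis using f(1) by (auto simp: max_integral_flow_def)
qed

text \<open>Every \<open>b\<close> in \<open>M r\<close> carries one unit along the path
  \<open>Source\<close>, \<open>Point b\<close>, \<open>Point r\<close>, \<open>Sink\<close>.
  Disjointness respects the unit capacity of the edge into \<open>b\<close>, and the size of
  \<open>M r\<close> fills the edge from \<open>r\<close> to the sink.\<close>

lemma saturating_flow:
  assumes "disjoint_family_on M R" and "\<And>r. r \<in> R \<Longrightarrow> M r \<subseteq> {b\<in>B. d' b r \<le> \<tau> * \<delta>}"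
    and "\<And>r. r \<in> R \<Longrightarrow> card (M r) = t"
  shows "\<exists>f. integral_flow N f \<and> flow_value N f = int t * int (card R)"
proof -
  define f where "f = (\<lambda>e. case e of
      (Source, Point b) \<Rightarrow> if \<exists>r\<in>R. b \<in> M r then 1 else 0
    | (Point b, Point r) \<Rightarrow> if r \<in> R \<and> b \<in> M r then 1 else 0
    | (Point r, Sink) \<Rightarrow> if r \<in> R then int t else 0
    | _ \<Rightarrow> 0)"
  have f_simps: "f (Source, Point b) = (if \<exists>r\<in>R. b \<in> M r then 1 else 0)"
    "f (Point b, Point r) = (if r \<in> R \<and> b \<in> M r then 1 else 0)"
    "f (Point r, Sink) = (if r \<in> R then int t else 0)" for b r
    by (simp_all add: f_def)
  have into: "(\<Sum>b\<in>B. f (Point b, Point r)) = int t" if r: "r \<in> R" for r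
  proof -
    have "B \<inter> M r = M r" using assms(2)[OF r] by blast
    then show ?thesis using r assms(3)[OF r] finB
      by (simp add: f_simps sum.If_cases)
  qed
  have out: "(\<Sum>r\<in>R. f (Point b, Point r)) = f (Source, Point b)" for b
  proof (cases "\<exists>r\<in>R. b \<in> M r")
    case True
    then obtain r where r: "r \<in> R" "b \<in> M r" by blast
    have "f (Point b, Point s) = (if s = r then 1 else 0)" if "s \<in> R" for s
      using r that assms(1) by (auto simp: f_simps disjoint_family_on_def)
    then have "(\<Sum>s\<in>R. f (Point b, Point s)) = 1"
      using r finR by (simp add: sum.delta)
    then show ?thesis using True by (simp add: f_simps)
  next
    case False
    then have "f (Point b, Point r) = 0" if "r \<in> R" for r
      using that by (simp add: f_simps)
    then show ?thesis using False by (simp add: f_simps)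
  qed
  have supp: "f e = 0" if "e \<notin> nw_edges N" for e
  proof -
    have "M r \<subseteq> {b\<in>B. d' b r \<le> \<tau> * \<delta>}" if "r \<in> R" for r using assms(2) that .
    then have "\<forall>r\<in>R. \<forall>b\<in>M r. b \<in> B \<and> d' b r \<le> \<tau> * \<delta>" by blast
    with that show ?thesis
      by (auto simp: f_def edges_eq split: prod.splits vertex.splits)
  qed
  have cap: "0 \<le> f e \<and> f e \<le> nw_cap N e" for e
    by (auto simp: f_def fairlet_network_def split: prod.splits vertex.splits)
  have flow: "integral_flow N f"
    using cap supp into out by (simp add: integral_flow_iff f_simps)
  moreover have "flow_value N f = int t * int (card R)"
    by (simp add: flow_value_centers[OF flow] f_simps)
  ultimately show ?thesis by blast
qed

text \<open>The slacks on the sink edges are nonnegative and sum to zero, so every \<open>r\<close>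
  receives exactly \<open>t\<close> units. A point shared by two copies would have to pass two units
  through its incoming edge of capacity one.\<close>

lemma saturated_centers:
  assumes flow: "integral_flow N f" and val: "flow_value N f = int t * int (card R)"
  defines "M \<equiv> \<lambda>r. {b\<in>B. f (Point b, Point r) = 1}"
  shows "disjoint_family_on M R"
    and "r \<in> R \<Longrightarrow> card (M r) = t"
    and "r \<in> R \<Longrightarrow> b \<in> M r \<Longrightarrow> d' b r \<le> \<tau> * \<delta>"
proof -
  show "disjoint_family_on M R"
    unfolding disjoint_family_on_def
  proof (intro ballI impI, rule ccontr)
    fix r s assume rs: "r \<in> R" "s \<in> R" "r \<noteq> s" "M r \<inter> M s \<noteq> {}"
    then obtain b where b: "b \<in> B" "f (Point b, Point r) = 1" "f (Point b, Point s) = 1"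
      by (auto simp: M_def)
    have "2 = (\<Sum>q\<in>{r, s}. f (Point b, Point q))" using rs b by simp
    also have "\<dots> \<le> (\<Sum>q\<in>R. f (Point b, Point q))"
      using rs finR by (intro sum_mono2) (auto intro: flow_bounds[OF flow])
    also have "\<dots> = f (Source, Point b)" using b flow by (simp add: integral_flow_iff)
    also have "\<dots> \<le> 1" using flow_bounds[OF flow] b by simp
    finally show False by simp
  qed
  show "card (M r) = t" if r: "r \<in> R"
  proof -
    have "(\<Sum>r\<in>R. int t - f (Point r, Sink)) = 0"
      using val by (simp add: flow_value_centers[OF flow] sum_subtractf)
    then have "int t = f (Point r, Sink)"
      using r finR flow_bounds(4)[OF flow] by (subst (asm) sum_nonneg_eq_0_iff) auto
    also have "\<dots> = (\<Sum>b\<in>B. f (Point b, Point r))" using r flow by (simp add: integral_flow_iff)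
    \<comment> \<open>Integrality enters here: a middle edge carries 0 or 1, so the inflow is a
      number of points.\<close>
    also have "\<dots> = (\<Sum>b\<in>B. if f (Point b, Point r) = 1 then 1 else 0)"
      using flow_bounds(1,2)[OF flow] by (intro sum.cong) (auto, smt (verit))
    also have "\<dots> = int (card (M r))"
      using finB by (simp add: sum.If_cases M_def Int_def)
    finally show ?thesis by simp
  qed
  show "d' b r \<le> \<tau> * \<delta>" if "r \<in> R" "b \<in> M r"
    using flow_bounds(5)[OF flow] that by (auto simp: M_def)
qed

end

section \<open>Searching for the first successful threshold\<close>

lemma find_sorted_list_le:
  fixes D :: "'b::linorder set"
  assumes "finite D" "x \<in> D" "Q x"
  shows "\<exists>y. find Q (sorted_list_of_set D) = Some y \<and> y \<in> D \<and> Q y \<and> y \<le> x"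
proof (cases "find Q (sorted_list_of_set D)")
  case None
  then show ?thesis using assms by (auto simp: find_None_iff)
next
  case (Some y)
  then obtain i where i: "i < length (sorted_list_of_set D)" "Q (sorted_list_of_set D ! i)"
    "y = sorted_list_of_set D ! i" "\<And>j. j < i \<Longrightarrow> \<not> Q (sorted_list_of_set D ! j)"
    by (auto simp: find_Some_iff)
  from assms obtain j where j: "j < length (sorted_list_of_set D)" "sorted_list_of_set D ! j = x"
    by (metis in_set_conv_nth set_sorted_list_of_set)
  \<comment> \<open>Positions before \<open>i\<close> fail the test, whereas \<open>x\<close> at
    position \<open>j\<close> passes it; sortedness then compares the values.\<close>
  then have "i \<le> j" using i(4) assms(3) by (metis linorder_not_le)
  then have "y \<le> x" using i j by (metis sorted_nth_mono sorted_sorted_list_of_set)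
  then show ?thesis using Some i assms(1) by (metis nth_mem set_sorted_list_of_set)
qed

lemma compute_1t_fairlets_exists:
  assumes "finite R" "finite B" "R \<inter> B = {}"
  shows "\<exists>res. compute_1t_fairlets P' d' R B t \<tau> res"
proof -
  have "\<forall>\<delta>. \<exists>f. max_integral_flow (fairlet_network d' R B t \<tau> \<delta>) f"
    using assms by (intro allI fairlet_net.max_integral_flow_exists) (simp add: fairlet_net_def)
  then obtain \<phi> where "\<forall>\<delta>. max_integral_flow (fairlet_network d' R B t \<tau> \<delta>) (\<phi> \<delta>)" by metis
  then show ?thesis unfolding compute_1t_fairlets_def Let_def by blast
qed

text \<open>\<open>d' x y\<close> is a threshold that the analysis knows to be good, later OPT.
  Hall's condition at this threshold rules out a failed search and bounds the threshold at which the
  search stops; the sets \<open>M r\<close> are read off the flow at the latter.\<close>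

lemma compute_1t_fairlets_correct:
  assumes "finite P'" "R \<subseteq> P'" "B \<subseteq> P'" "R \<inter> B = {}" "0 \<le> \<tau>"
    and "x \<in> P'" "y \<in> P'"
    and hall: "\<And>S. S \<subseteq> R \<Longrightarrow> t * card S \<le> card (\<Union>r\<in>S. {b\<in>B. d' b r \<le> \<tau> * d' x y})"
    and comp: "compute_1t_fairlets P' d' R B t \<tau> res"
  shows "\<exists>M. res = Some {insert r (M r) |r. r \<in> R} \<and> disjoint_family_on M R \<and>
    (\<forall>r\<in>R. M r \<subseteq> B \<and> card (M r) = t \<and> (\<forall>b\<in>M r. d' b r \<le> \<tau> * d' x y))"
proof -
  let ?D = "{d' x y |x y. x \<in> P' \<and> y \<in> P'}"
  let ?N = "fairlet_network d' R B t \<tau>"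
  have fin: "finite R" "finite B" using assms finite_subset by blast+
  interpret fairlet_net d' R B t \<tau> \<delta> for \<delta> using fin assms(4) by unfold_locales
  have "?D = (\<lambda>(x, y). d' x y) ` (P' \<times> P')" by auto
  then have finD: "finite ?D" using assms(1) by simp
  have inD: "d' x y \<in> ?D" using assms by auto
  obtain \<phi> where \<phi>: "\<And>\<delta>. \<delta> \<in> ?D \<Longrightarrow> max_integral_flow (?N \<delta>) (\<phi> \<delta>)"
    and res: "res = map_option (\<lambda>\<delta>. {insert r {b\<in>B. \<phi> \<delta> (Point b, Point r) = 1} |r. r \<in> R})
        (find (\<lambda>\<delta>. flow_value (?N \<delta>) (\<phi> \<delta>) = int t * int (card R)) (sorted_list_of_set ?D))"
    using comp unfolding compute_1t_fairlets_def Let_def by blast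
  obtain M where M: "disjoint_family_on M R"
    "\<forall>r\<in>R. M r \<subseteq> {b\<in>B. d' b r \<le> \<tau> * d' x y} \<and> card (M r) = t"
    using hall_capacitated[OF fin(1), of "\<lambda>r. {b\<in>B. d' b r \<le> \<tau> * d' x y}" t] hall fin(2) by auto
  then obtain g where "integral_flow (?N (d' x y)) g"
      "flow_value (?N (d' x y)) g = int t * int (card R)"
    using saturating_flow[of M] by blast
  \<comment> \<open>The flow \<open>g\<close> comes from Hall's theorem and \<open>\<phi>\<close>
    from the algorithm: maximality gives one inequality, the sink cut the other.\<close>
  then have "flow_value (?N (d' x y)) (\<phi> (d' x y)) = int t * int (card R)"
    using \<phi>[OF inD] flow_value_le by (metis max_integral_flow_def order_antisym)
  from find_sorted_list_le[OF finD inD, of "\<lambda>\<delta>. flow_value (?N \<delta>) (\<phi> \<delta>) = int t * int (card R)", OF this]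
  obtain \<delta> where \<delta>: "find (\<lambda>\<delta>. flow_value (?N \<delta>) (\<phi> \<delta>) = int t * int (card R)) (sorted_list_of_set ?D) = Some \<delta>"
    "\<delta> \<in> ?D" "flow_value (?N \<delta>) (\<phi> \<delta>) = int t * int (card R)" "\<delta> \<le> d' x y" by blast
  have flow: "integral_flow (?N \<delta>) (\<phi> \<delta>)" using \<phi>[OF \<delta>(2)] by (simp add: max_integral_flow_def)
  have le: "\<tau> * \<delta> \<le> \<tau> * d' x y" using \<delta>(4) assms(5) by (rule mult_left_mono)
  show ?thesis
    using saturated_centers[OF flow \<delta>(3)] le res \<delta>(1)
    by (intro exI[of _ "\<lambda>r. {b\<in>B. \<phi> \<delta> (Point b, Point r) = 1}"]) fastforce
qed

section \<open>Capacitated centers\<close>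

lemma finite_copies: "finite (copies A)" and card_copies: "card (copies A) = size A"
proof -
  have "copies A = (SIGMA a:set_mset A. {..<count A a})"
    by (auto simp: copies_def not_in_iff intro: count_inI)
  then show "finite (copies A)" "card (copies A) = size A"
    by (simp_all add: size_multiset_overloaded_eq)
qed

lemma fst_copies: "c \<in> copies A \<Longrightarrow> fst c \<in># A"
  by (auto simp: copies_def simp flip: count_greater_zero_iff)

text \<open>Each fibre of \<open>g\<close> is enumerated and cut into blocks of \<open>u\<close>
  consecutive positions, one block for each copy of its center. Divisibility makes all blocks full,
  so the number of copies adds up to at most \<open>card X div u\<close>.\<close>

lemma cap_center_solution_of_assignment:
  assumes fin: "finite X" and g: "g ` X \<subseteq> X" and u: "u > 0"
    and dvd: "\<And>y. y \<in> X \<Longrightarrow> u dvd card {p\<in>X. g p = y}"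
  shows "\<exists>A \<kappa>. cap_center_solution X (card X div u) u A \<kappa> \<and> (\<forall>p\<in>X. fst (\<kappa> p) = g p)"
proof -
  define fib where "fib y = {p\<in>X. g p = y}" for y
  have finfib: "finite (fib y)" for y using fin by (simp add: fib_def)
  have dvd': "u * (card (fib y) div u) = card (fib y)" for y
  proof (cases "y \<in> X")
    case True
    then show ?thesis using dvd by (simp add: fib_def)
  next
    case False
    then have "fib y = {}" using g by (auto simp: fib_def)
    then show ?thesis by simp
  qed
  have "\<forall>y. \<exists>e. bij_betw e (fib y) {0..<card (fib y)}"
    using ex_bij_betw_finite_nat[OF finfib] by blast
  then obtain e where e: "\<And>y. bij_betw (e y) (fib y) {0..<card (fib y)}" by metis
  \<comment> \<open>These are the counts of \<open>A\<close> only once the support is known to be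
    finite, which is shown next.\<close>
  define A where "A = Abs_multiset (\<lambda>y. card (fib y) div u)"
  have "{y. 0 < card (fib y) div u} \<subseteq> X"
  proof
    fix y assume "y \<in> {y. 0 < card (fib y) div u}"
    then have "fib y \<noteq> {}" by auto
    then show "y \<in> X" using g by (auto simp: fib_def)
  qed
  moreover from this have "finite {y. 0 < card (fib y) div u}" using fin finite_subset by blast
  ultimately have cnt: "count A y = card (fib y) div u" and AX: "set_mset A \<subseteq> X" for y
    by (simp_all add: A_def Abs_multiset_inverse set_mset_def)
  have "u * size A = (\<Sum>y\<in>set_mset A. u * count A y)"
    by (simp add: size_multiset_overloaded_eq sum_distrib_left)
  also have "\<dots> = (\<Sum>y\<in>set_mset A. card (fib y))" by (simp add: cnt dvd')
  also have "\<dots> \<le> (\<Sum>y\<in>X. card (fib y))" using fin AX by (intro sum_mono2) auto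
  also have "\<dots> = card X"
    using sum_fun_comp[OF fin fin g, of "\<lambda>_. 1::nat"] by (simp add: fib_def)
  finally have size: "size A \<le> card X div u"
    using u by (simp add: less_eq_div_iff_mult_less_eq mult.commute)
  define \<kappa> where "\<kappa> p = (g p, e (g p) p div u)" for p
  have "\<kappa> ` X \<subseteq> copies A"
  proof
    fix z assume "z \<in> \<kappa> ` X"
    then obtain p where p: "p \<in> X" "z = \<kappa> p" by blast
    then have "p \<in> fib (g p)" by (simp add: fib_def)
    then have "e (g p) p < card (fib (g p))" using e[of "g p"] by (auto simp: bij_betw_def)
    \<comment> \<open>With an incomplete last block the index could equal the number of copies;
      exact divisibility by \<open>u\<close> excludes this.\<close>
    then have "e (g p) p div u < card (fib (g p)) div u"
      using u dvd'[of "g p"] by (metis div_less_iff_less_mult mult.commute)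
    then show "z \<in> copies A" using p by (simp add: \<kappa>_def copies_def cnt)
  qed
  moreover have "card {p\<in>X. \<kappa> p = c} \<le> u" for c
  proof -
    obtain y j where c: "c = (y, j)" by (cases c)
    have "inj_on (e y) {p\<in>X. \<kappa> p = c}"
      using e[of y] by (auto simp: bij_betw_def c \<kappa>_def fib_def intro: inj_on_subset)
    moreover have "e y ` {p\<in>X. \<kappa> p = c} \<subseteq> {j * u..<j * u + u}"
    proof
      fix n assume "n \<in> e y ` {p\<in>X. \<kappa> p = c}"
      then have "n div u = j" by (auto simp: c \<kappa>_def)
      then show "n \<in> {j * u..<j * u + u}"
        using u dividend_less_div_times[of u n] by auto
    qed
    ultimately have "card {p\<in>X. \<kappa> p = c} \<le> card {j * u..<j * u + u}"
      by (intro card_inj_on_le) auto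
    then show ?thesis by simp
  qed
  ultimately have "cap_center_solution X (card X div u) u A \<kappa>"
    using AX size by (simp add: cap_center_solution_def)
  then show ?thesis by (intro exI[of _ A] exI[of _ \<kappa>]) (simp add: \<kappa>_def)
qed

lemma cap_center_solution_full:
  assumes fin: "finite X" and sol: "cap_center_solution X l u A \<kappa>" and X: "card X = l * u" and "u > 0"
  shows "card (copies A) = l" and "c \<in> copies A \<Longrightarrow> card {p\<in>X. \<kappa> p = c} = u"
proof -
  have img: "\<kappa> ` X \<subseteq> copies A" and le: "card (copies A) \<le> l"
    and cap: "\<And>c. c \<in> copies A \<Longrightarrow> card {p\<in>X. \<kappa> p = c} \<le> u"
    using sol by (auto simp: cap_center_solution_def card_copies)
  have sum: "(\<Sum>c\<in>copies A. card {p\<in>X. \<kappa> p = c}) = l * u"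
    using sum_fun_comp[OF fin finite_copies img, of "\<lambda>_. 1::nat"] X by simp
  moreover have "(\<Sum>c\<in>copies A. card {p\<in>X. \<kappa> p = c}) \<le> card (copies A) * u"
    using sum_mono[OF cap, of "copies A" "\<lambda>c. c"] by simp
  ultimately show eq: "card (copies A) = l" using le \<open>u > 0\<close> by simp
  have "(\<Sum>c\<in>copies A. u - card {p\<in>X. \<kappa> p = c}) = 0"
    using sum eq cap by (simp add: sum_subtractf_nat)
  then show "card {p\<in>X. \<kappa> p = c} = u" if "c \<in> copies A"
    using that cap[OF that] finite_copies[of A] by (fastforce simp: sum_eq_0_iff)
qed

lemma cap_center_cost_le_iff:
  assumes "finite X" "X \<noteq> {}"
  shows "cap_center_cost X d \<kappa> \<le> r \<longleftrightarrow> (\<forall>p\<in>X. d p (fst (\<kappa> p)) \<le> r)"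
  using assms by (simp add: cap_center_cost_def)

text \<open>The solutions themselves may be infinitely many, since \<open>\<kappa>\<close> is
  arbitrary outside \<open>X\<close>. Their costs are distances between points of \<open>X\<close>,
  so the \<open>Min\<close> defining the optimum is meaningful.\<close>

lemma cap_center_costs_finite:
  assumes "finite X" "X \<noteq> {}"
  shows "finite {cap_center_cost X d \<kappa> |A \<kappa>. cap_center_solution X l u A \<kappa>}"
proof -
  have "cap_center_cost X d \<kappa> \<in> (\<lambda>(x, y). d x y) ` (X \<times> X)"
    if "cap_center_solution X l u A \<kappa>" for A \<kappa>
  proof -
    have "cap_center_cost X d \<kappa> \<in> (\<lambda>p. d p (fst (\<kappa> p))) ` X"
      unfolding cap_center_cost_def using assms by (intro Max_in) auto
    moreover have "fst (\<kappa> p) \<in> X" if "p \<in> X" for p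
    proof -
      have "\<kappa> p \<in> copies A" using \<open>cap_center_solution X l u A \<kappa>\<close> that
        by (auto simp: cap_center_solution_def)
      then have "fst (\<kappa> p) \<in># A" by (rule fst_copies)
      then show ?thesis using \<open>cap_center_solution X l u A \<kappa>\<close> by (auto simp: cap_center_solution_def)
    qed
    ultimately show ?thesis by force
  qed
  then have "{cap_center_cost X d \<kappa> |A \<kappa>. cap_center_solution X l u A \<kappa>}
      \<subseteq> (\<lambda>(x, y). d x y) ` (X \<times> X)" by blast
  then show ?thesis by (rule finite_subset) (simp add: assms(1))
qed

lemma cap_center_opt_le:
  assumes "finite X" "X \<noteq> {}" "cap_center_solution X l u A \<kappa>"
  shows "cap_center_opt X d l u \<le> cap_center_cost X d \<kappa>"
  unfolding cap_center_opt_def using assms cap_center_costs_finite[of X d l u]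
  by (intro Min_le) auto

text \<open>An optimal solution is a \<open>c\<close>-approximate one, since costs are nonnegative
  and \<open>c \<ge> 1\<close>. This provides the first choice in a run of the algorithm.\<close>

lemma cap_center_approx_exists:
  assumes "finite X" "X \<noteq> {}" "cap_center_solution X l u A \<kappa>" "c \<ge> 1" "\<And>x y. 0 \<le> d x y"
  shows "\<exists>A \<kappa>. cap_center_approx c X d l u A \<kappa>"
proof -
  have "cap_center_opt X d l u \<in> {cap_center_cost X d \<kappa> |A \<kappa>. cap_center_solution X l u A \<kappa>}"
    unfolding cap_center_opt_def using assms cap_center_costs_finite[of X d l u]
    by (intro Min_in) auto
  then obtain A \<kappa> where A: "cap_center_solution X l u A \<kappa>"
    "cap_center_opt X d l u = cap_center_cost X d \<kappa>" by blast
  have "0 \<le> cap_center_cost X d \<kappa>"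
  proof -
    obtain p where "p \<in> X" using assms by blast
    then have "d p (fst (\<kappa> p)) \<le> cap_center_cost X d \<kappa>"
      using cap_center_cost_le_iff[of X d \<kappa>] assms by blast
    then show ?thesis using assms(5) order_trans by blast
  qed
  then have "cap_center_cost X d \<kappa> \<le> c * cap_center_cost X d \<kappa>"
    using assms(4) by (simp add: mult_le_cancel_right1)
  then show ?thesis using A by (auto simp: cap_center_approx_def)
qed

section \<open>Optimal fair clusterings\<close>

locale fair_instance = Metric_space P d for P :: "'a set" and d +
  fixes H :: "nat \<Rightarrow> 'a set" and t :: "nat \<Rightarrow> nat" and m k :: nat
  assumes finP: "finite P" and m: "m \<ge> 1"
    and P_eq: "P = (\<Union>i\<in>{1..m}. H i)" and disjH: "disjoint_family_on H {1..m}"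
    and t_pos: "\<And>i. i \<in> {1..m} \<Longrightarrow> t i > 0" and coprime: "Gcd (t ` {1..m}) = 1"
    and H1: "card (H 1) > 0" and t1_dvd: "t 1 dvd card (H 1)"
    and card_H: "\<And>i. i \<in> {2..m} \<Longrightarrow> real (card (H i)) \<ge> real (t i) / real (t 1) * real (card (H 1))"
    and k: "k \<ge> 1"
begin

abbreviation "L \<equiv> card (H 1) div t 1"

lemma t1: "t 1 > 0" using t_pos m by simp

lemma H_sub: "i \<in> {1..m} \<Longrightarrow> H i \<subseteq> P" using P_eq by blast

lemma finH: "i \<in> {1..m} \<Longrightarrow> finite (H i)" using H_sub finP finite_subset by blast

lemma H1_props: "finite (H 1)" "H 1 \<noteq> {}" "H 1 \<subseteq> P" "card (H 1) = L * t 1"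
  using H1 H_sub[of 1] m t1_dvd by (auto simp: card_gt_0_iff)

text \<open>Divisibility turns the real quotient into the integer \<open>t i * L\<close>;
  \<open>L\<close> is the number of fairlets to be formed.\<close>

lemma num_outliers_eq: "num_outliers H t i = real (card (H i)) - real (t i * L)"
proof -
  have "real (card (H 1)) = real L * real (t 1)" using H1_props(4) by (metis of_nat_mult)
  then show ?thesis using t1 by (simp add: num_outliers_def)
qed

lemma card_H_ge:
  assumes "i \<in> {1..m}"
  shows "t i * L \<le> card (H i)"
proof (cases "i = 1")
  case True
  then show ?thesis using H1_props(4) by simp
next
  case False
  then have "0 \<le> num_outliers H t i" using card_H[of i] assms by (simp add: num_outliers_def)
  then show ?thesis by (simp add: num_outliers_eq flip: of_nat_mult)
qed

text \<open>A single cluster with \<open>t i * L\<close> points of each colour around an arbitrary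
  center is fair. It shows that OPT is the minimum of a nonempty set.\<close>

lemma fair_clustering_exists: "\<exists>C \<alpha>. fair_clustering P H t m k C \<alpha>"
proof -
  obtain c where c: "c \<in> P" using H1_props by blast
  have "\<forall>i\<in>{1..m}. \<exists>S. S \<subseteq> H i \<and> card S = t i * L"
    using card_H_ge by (meson obtain_subset_with_card_n)
  then obtain S where S: "\<And>i. i \<in> {1..m} \<Longrightarrow> S i \<subseteq> H i \<and> card (S i) = t i * L" by metis
  define \<alpha> where "\<alpha> x = (if \<exists>i\<in>{1..m}. x \<in> S i then Some c else None)" for x
  have in_S: "\<alpha> x = Some c \<longleftrightarrow> x \<in> S i" "\<alpha> x = None \<longleftrightarrow> x \<notin> S i" if "i \<in> {1..m}" "x \<in> H i" for x i
  proof -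
    have "x \<notin> S j" if "j \<in> {1..m}" "j \<noteq> i" for j
    proof -
      have "H j \<inter> H i = {}"
        using disjH that \<open>i \<in> {1..m}\<close> unfolding disjoint_family_on_def by blast
      then show ?thesis using S[OF that(1)] \<open>x \<in> H i\<close> by blast
    qed
    then have "(\<exists>j\<in>{1..m}. x \<in> S j) \<longleftrightarrow> x \<in> S i" using that(1) by blast
    then show "\<alpha> x = Some c \<longleftrightarrow> x \<in> S i" "\<alpha> x = None \<longleftrightarrow> x \<notin> S i"
      by (simp_all add: \<alpha>_def)
  qed
  have Q: "{x\<in>P. \<alpha> x = Some c} \<inter> H i = S i" if "i \<in> {1..m}" for i
    using in_S(1)[OF that] S[OF that] H_sub[OF that] by blast
  have out: "real (card {x\<in>H i. \<alpha> x = None}) = num_outliers H t i" if "i \<in> {1..m}" for i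
  proof -
    have "{x\<in>H i. \<alpha> x = None} = H i - S i" using in_S(2)[OF that] by blast
    moreover have "card (H i - S i) = card (H i) - t i * L"
      using S[OF that] finH[OF that] by (metis card_Diff_subset finite_subset)
    ultimately show ?thesis using card_H_ge[OF that] by (simp add: num_outliers_eq)
  qed
  have "card (S 1) = t 1 * L" using S m by simp
  then have "fair_clustering P H t m k {c} \<alpha>"
    using c k Q out S m by (auto simp: fair_clustering_def Let_def \<alpha>_def)
  then show ?thesis by blast
qed

lemma fair_clustering_H1_assigned:
  assumes "fair_clustering P H t m k C \<alpha>" "x \<in> H 1"
  shows "\<exists>c\<in>C. \<alpha> x = Some c"
proof -
  have "real (card {x\<in>H 1. \<alpha> x = None}) = num_outliers H t 1"
    using assms(1) m by (simp add: fair_clustering_def)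
  also have "\<dots> = 0" using t1 by (simp add: num_outliers_def)
  finally have "{x\<in>H 1. \<alpha> x = None} = {}" using H1_props(1) by simp
  moreover have "\<alpha> x \<in> insert None (Some ` C)"
    using assms H1_props(3) by (auto simp: fair_clustering_def)
  ultimately show ?thesis using assms(2) by auto
qed

text \<open>The first part puts every cost, hence OPT, among the distances of the instance, where
  the threshold search can meet it. The cost is a maximum over a nonempty set because the points of
  \<open>H 1\<close> are assigned.\<close>

lemma clustering_cost_props:
  assumes fair: "fair_clustering P H t m k C \<alpha>"
  shows "\<exists>x\<in>P. \<exists>c\<in>P. clustering_cost P d \<alpha> = d x c"
    and "x \<in> P \<Longrightarrow> \<alpha> x = Some c \<Longrightarrow> d x c \<le> clustering_cost P d \<alpha>"
proof -
  let ?D = "{d x c |x c. x \<in> P \<and> \<alpha> x = Some c}"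
  have sub: "C \<subseteq> P" and range: "\<And>x. x \<in> P \<Longrightarrow> \<alpha> x \<in> insert None (Some ` C)"
    using fair by (auto simp: fair_clustering_def)
  have "?D \<subseteq> (\<lambda>(x, y). d x y) ` (P \<times> P)" using sub range by fastforce
  then have fin: "finite ?D" using finP by (meson finite_SigmaI finite_imageI finite_subset)
  obtain y where "y \<in> H 1" using H1_props by blast
  with fair_clustering_H1_assigned[OF fair this] H1_props(3) have "?D \<noteq> {}" by blast
  with fin have "clustering_cost P d \<alpha> \<in> ?D" unfolding clustering_cost_def by (rule Max_in)
  then show "\<exists>x\<in>P. \<exists>c\<in>P. clustering_cost P d \<alpha> = d x c" using sub range by fastforce
  show "d x c \<le> clustering_cost P d \<alpha>" if "x \<in> P" "\<alpha> x = Some c"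
    unfolding clustering_cost_def using fin that by (intro Max_ge) auto
qed

section \<open>The optimal clustering and Hall's condition\<close>

abbreviation "OPT \<equiv> OPT_fair P d H t m k"

lemma optimal_clustering:
  obtains C \<alpha> where "fair_clustering P H t m k C \<alpha>"
    and "\<And>x c. x \<in> P \<Longrightarrow> \<alpha> x = Some c \<Longrightarrow> d x c \<le> OPT"
    and "\<exists>x\<in>P. \<exists>y\<in>P. OPT = d x y"
proof -
  let ?K = "{clustering_cost P d \<alpha> |C \<alpha>. fair_clustering P H t m k C \<alpha>}"
  have "?K \<subseteq> (\<lambda>(x, y). d x y) ` (P \<times> P)" using clustering_cost_props(1) by fastforce
  then have "finite ?K" using finP by (meson finite_SigmaI finite_imageI finite_subset)
  moreover have "?K \<noteq> {}" using fair_clustering_exists by blast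
  ultimately have "OPT \<in> ?K" unfolding OPT_fair_def by (rule Min_in)
  then obtain C \<alpha> where "fair_clustering P H t m k C \<alpha>" "OPT = clustering_cost P d \<alpha>" by blast
  then show thesis using that clustering_cost_props by metis
qed

lemma t1_dvd_cluster:
  assumes "fair_clustering P H t m k C \<alpha>" "c \<in> C"
  shows "t 1 dvd card ({x\<in>P. \<alpha> x = Some c} \<inter> H 1)"
proof -
  let ?n = "card ({x\<in>P. \<alpha> x = Some c} \<inter> H 1)"
  have dvd: "t 1 dvd t i * ?n" if "i \<in> {1..m}" for i
  proof -
    have "t 1 * card ({x\<in>P. \<alpha> x = Some c} \<inter> H i) = t i * ?n"
      using assms that by (simp add: fair_clustering_def Let_def)
    then show ?thesis by (rule dvdI[OF sym])
  qed
  have "t 1 dvd Gcd ((*) ?n ` t ` {1..m})"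
  proof (rule Gcd_greatest)
    fix z assume "z \<in> (*) ?n ` t ` {1..m}"
    then obtain i where "i \<in> {1..m}" "z = t i * ?n" by (auto simp: mult.commute)
    then show "t 1 dvd z" using dvd by simp
  qed
  also have "Gcd ((*) ?n ` t ` {1..m}) = ?n" using coprime by (simp add: Gcd_mult)
  finally show ?thesis .
qed

text \<open>The capacitated problem admits only centers from \<open>H 1\<close>, so an optimal
  center is replaced by a point of \<open>H 1\<close> in its cluster; the detour through the old
  center costs the factor 2.\<close>

lemma cap_center_solution_2OPT:
  "\<exists>A \<kappa>. cap_center_solution (H 1) L (t 1) A \<kappa> \<and> cap_center_cost (H 1) d \<kappa> \<le> 2 * OPT"
proof -
  obtain C \<alpha> where fair: "fair_clustering P H t m k C \<alpha>"
    and near: "\<And>x c. x \<in> P \<Longrightarrow> \<alpha> x = Some c \<Longrightarrow> d x c \<le> OPT"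
    using optimal_clustering by metis
  \<comment> \<open>The choice depends on \<open>\<alpha> p\<close> alone, so all points of a
    cluster get the same representative and every fibre of \<open>g\<close> is empty or the whole
    part of a cluster in \<open>H 1\<close>.\<close>
  define g where "g p = (SOME x. x \<in> H 1 \<and> \<alpha> x = \<alpha> p)" for p
  have g: "g p \<in> H 1 \<and> \<alpha> (g p) = \<alpha> p" if "p \<in> H 1" for p
    unfolding g_def by (rule someI[of _ p]) (use that in simp)
  have g_cong: "g p = g q" if "\<alpha> p = \<alpha> q" for p q using that by (simp add: g_def)
  have "\<exists>A \<kappa>. cap_center_solution (H 1) L (t 1) A \<kappa> \<and> (\<forall>p\<in>H 1. fst (\<kappa> p) = g p)"
  proof (rule cap_center_solution_of_assignment)
    fix y assume y: "y \<in> H 1"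
    obtain c where c: "c \<in> C" "\<alpha> y = Some c" using fair_clustering_H1_assigned[OF fair y] by blast
    show "t 1 dvd card {p\<in>H 1. g p = y}"
    proof (cases "\<exists>p\<in>H 1. g p = y")
      case True
      then obtain q where q: "q \<in> H 1" "g q = y" by blast
      have "g p = y \<longleftrightarrow> \<alpha> p = Some c" if p: "p \<in> H 1" for p
        using g[OF p] g[OF q(1)] g_cong[of p q] q(2) c(2) by auto
      then have "{p\<in>H 1. g p = y} = {x\<in>P. \<alpha> x = Some c} \<inter> H 1"
        using H1_props(3) by blast
      then show ?thesis using t1_dvd_cluster[OF fair c(1)] by simp
    next
      case False
      then have "{p\<in>H 1. g p = y} = {}" by blast
      then show ?thesis by (simp only: card.empty dvd_0_right)
    qed
  qed (use g H1_props t1 in auto)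
  then obtain A \<kappa> where sol: "cap_center_solution (H 1) L (t 1) A \<kappa>"
    and \<kappa>: "\<And>p. p \<in> H 1 \<Longrightarrow> fst (\<kappa> p) = g p" by blast
  have "d p (g p) \<le> 2 * OPT" if p: "p \<in> H 1" for p
  proof -
    obtain c where c: "c \<in> C" "\<alpha> p = Some c" using fair_clustering_H1_assigned[OF fair p] by blast
    have in_P: "p \<in> P" "g p \<in> P" "c \<in> P"
      using p g[OF p] c(1) fair H1_props(3) by (auto simp: fair_clustering_def)
    have "d p (g p) \<le> d p c + d (g p) c" using triangle'[OF in_P(1,3,2)] .
    also have "\<dots> \<le> OPT + OPT" using near in_P g[OF p] c by (intro add_mono) auto
    finally show ?thesis by simp
  qed
  then have "cap_center_cost (H 1) d \<kappa> \<le> 2 * OPT"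
    using \<kappa> H1_props by (simp add: cap_center_cost_le_iff)
  then show ?thesis using sol by blast
qed

lemma cap_center_approx_OPT:
  assumes "cap_center_approx 5 (H 1) d L (t 1) A \<kappa>" "p \<in> H 1"
  shows "d p (fst (\<kappa> p)) \<le> 10 * OPT"
proof -
  obtain A' \<kappa>' where "cap_center_solution (H 1) L (t 1) A' \<kappa>'" "cap_center_cost (H 1) d \<kappa>' \<le> 2 * OPT"
    using cap_center_solution_2OPT by blast
  then have "cap_center_opt (H 1) d L (t 1) \<le> 2 * OPT"
    using cap_center_opt_le[OF H1_props(1,2)] by (meson order_trans)
  then have "cap_center_cost (H 1) d \<kappa> \<le> 10 * OPT"
    using assms(1) by (simp add: cap_center_approx_def)
  then show ?thesis using assms(2) H1_props by (simp add: cap_center_cost_le_iff)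
qed

text \<open>Fairness exchanges points of \<open>H 1\<close> for points of \<open>H i\<close> only
  within a whole cluster. So \<open>T\<close>, the points served by \<open>S\<close>, is first
  enlarged to all clusters that it meets; any point of such a cluster is still near
  \<open>S\<close>, by way of one point of \<open>T\<close> in the cluster.\<close>

lemma hall_condition:
  assumes approx: "cap_center_approx 5 (H 1) d L (t 1) A \<kappa>" and i: "i \<in> {1..m}"
    and S: "S \<subseteq> copies A"
  shows "t i * card S \<le> card (\<Union>a\<in>S. {b\<in>H i. d b (fst a) \<le> 12 * OPT})"
proof -
  obtain C \<alpha> where fair: "fair_clustering P H t m k C \<alpha>"
    and near: "\<And>x c. x \<in> P \<Longrightarrow> \<alpha> x = Some c \<Longrightarrow> d x c \<le> OPT"
    using optimal_clustering by metis
  have sol: "cap_center_solution (H 1) L (t 1) A \<kappa>" using approx by (simp add: cap_center_approx_def)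
  have finS: "finite S" using S finite_copies finite_subset by blast
  define Q where "Q c = {x\<in>P. \<alpha> x = Some c}" for c
  define T where "T = {p\<in>H 1. \<kappa> p \<in> S}"
  define C' where "C' = {c\<in>C. \<exists>p\<in>T. \<alpha> p = Some c}"
  have "C \<subseteq> P" using fair by (simp add: fair_clustering_def)
  then have finC': "finite C'" using finP by (auto simp: C'_def intro: finite_subset)
  have finQ: "finite (Q c \<inter> H j)" for c j using finP by (simp add: Q_def)
  have fairQ: "t 1 * card (Q c \<inter> H i) = t i * card (Q c \<inter> H 1)" if "c \<in> C'" for c
    using fair that i by (simp add: fair_clustering_def Let_def Q_def C'_def)
  \<comment> \<open>Equality, not just an upper bound: every copy is filled to capacity.\<close>
  have "card S * t 1 = (\<Sum>a\<in>S. card {p\<in>H 1. \<kappa> p = a})"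
  proof -
    have "card {p\<in>H 1. \<kappa> p = a} = t 1" if "a \<in> S" for a
      using S that by (intro cap_center_solution_full(2)[OF H1_props(1) sol H1_props(4) t1]) blast
    then show ?thesis by simp
  qed
  also have "\<dots> = card (\<Union>a\<in>S. {p\<in>H 1. \<kappa> p = a})"
    using finS H1_props(1) by (subst card_UN_disjoint) auto
  also have "(\<Union>a\<in>S. {p\<in>H 1. \<kappa> p = a}) = T" by (auto simp: T_def)
  also have "card T \<le> card (\<Union>c\<in>C'. Q c \<inter> H 1)"
  proof (rule card_mono)
    show "finite (\<Union>c\<in>C'. Q c \<inter> H 1)" using finC' finQ by blast
    show "T \<subseteq> (\<Union>c\<in>C'. Q c \<inter> H 1)"
    proof
      fix p assume p: "p \<in> T"
      then have pH: "p \<in> H 1" by (simp add: T_def)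
      then obtain c where "c \<in> C" "\<alpha> p = Some c" using fair_clustering_H1_assigned[OF fair] by blast
      then show "p \<in> (\<Union>c\<in>C'. Q c \<inter> H 1)" using p pH H1_props(3) by (auto simp: C'_def Q_def)
    qed
  qed
  also have "\<dots> \<le> (\<Sum>c\<in>C'. card (Q c \<inter> H 1))" using finC' by (rule card_UN_le)
  \<comment> \<open>The factor \<open>t i\<close> prepares for the fairness equations, which trade
    it for \<open>t 1\<close> while passing from \<open>H 1\<close> to \<open>H i\<close>; the
    common factor \<open>t 1\<close> is cancelled at the end.\<close>
  finally have "t i * (card S * t 1) \<le> t i * (\<Sum>c\<in>C'. card (Q c \<inter> H 1))" by simp
  also have "\<dots> = t 1 * (\<Sum>c\<in>C'. card (Q c \<inter> H i))"
    unfolding sum_distrib_left by (intro sum.cong refl fairQ[symmetric])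
  also have "(\<Sum>c\<in>C'. card (Q c \<inter> H i)) = card (\<Union>c\<in>C'. Q c \<inter> H i)"
    using finC' finQ by (subst card_UN_disjoint) (auto simp: Q_def)
  also have "\<dots> \<le> card (\<Union>a\<in>S. {b\<in>H i. d b (fst a) \<le> 12 * OPT})"
  proof (rule card_mono)
    show "finite (\<Union>a\<in>S. {b\<in>H i. d b (fst a) \<le> 12 * OPT})" using finS finH[OF i] by simp
    show "(\<Union>c\<in>C'. Q c \<inter> H i) \<subseteq> (\<Union>a\<in>S. {b\<in>H i. d b (fst a) \<le> 12 * OPT})"
    proof
      fix b assume "b \<in> (\<Union>c\<in>C'. Q c \<inter> H i)"
      then obtain c p where b: "b \<in> H i" "b \<in> P" "\<alpha> b = Some c"
        and c: "c \<in> C" and p: "p \<in> T" "\<alpha> p = Some c"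
        by (auto simp: C'_def Q_def)
      let ?a = "fst (\<kappa> p)"
      have pH: "p \<in> H 1" "\<kappa> p \<in> S" using p by (auto simp: T_def)
      have "?a \<in># A" using pH(2) S by (intro fst_copies) blast
      then have "?a \<in> P" using sol H1_props(3) by (auto simp: cap_center_solution_def)
      moreover have "p \<in> P" "c \<in> P" using pH H1_props(3) c \<open>C \<subseteq> P\<close> by auto
      ultimately have "d b ?a \<le> d b c + d p c + d p ?a"
        using triangle[of b p ?a] triangle'[of b c p] b(2) by simp
      also have "\<dots> \<le> OPT + OPT + 10 * OPT"
        using near b p \<open>p \<in> P\<close> cap_center_approx_OPT[OF approx pH(1)] by (intro add_mono) auto
      finally show "b \<in> (\<Union>a\<in>S. {b\<in>H i. d b (fst a) \<le> 12 * OPT})" using pH b by auto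
    qed
  qed
  finally show ?thesis using t1 by (simp add: ac_simps)
qed

section \<open>Gluing the colours and analysing a run of the algorithm\<close>

lemma underlying_Inl: "underlying (Inl c) = fst c"
  by (cases c) simp

text \<open>Gluing separated from the algorithm: \<open>K\<close> plays the set of copies and
  \<open>G i c\<close> the points of colour \<open>i\<close> given to \<open>c\<close>. Disjointness
  of the colour classes makes \<open>G i c\<close> the exact trace of \<open>U c\<close> on
  \<open>H i\<close>, so all counts can be made colour by colour.\<close>

lemma decomposition_of_families:
  assumes K: "card K = L"
    and disj: "\<And>i. i \<in> {1..m} \<Longrightarrow> disjoint_family_on (G i) K"
    and sub: "\<And>i c. i \<in> {1..m} \<Longrightarrow> c \<in> K \<Longrightarrow> G i c \<subseteq> H i"
    and card: "\<And>i c. i \<in> {1..m} \<Longrightarrow> c \<in> K \<Longrightarrow> card (G i c) = t i"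
  defines "U \<equiv> \<lambda>c. \<Union>i\<in>{1..m}. G i c"
  shows "inj_on U K" and "fairlet_decomposition P H t m (U ` K)"
    and "i \<in> {1..m} \<Longrightarrow> real (card (H i - \<Union>(U ` K))) = num_outliers H t i"
proof -
  \<comment> \<open>\<open>card\<close> is 0 on infinite sets, so finiteness of \<open>K\<close> is
    obtained from a positive cardinality.\<close>
  have "L > 0" using H1 H1_props(4) by (metis gr0I mult_0)
  then have finK: "finite K" using K card.infinite by fastforce
  have one: "1 \<in> {1..m}" using m by simp
  have disjHH: "H i \<inter> H j = {}" if "i \<in> {1..m}" "j \<in> {1..m}" "i \<noteq> j" for i j
    using disjH that unfolding disjoint_family_on_def by blast
  have U_H: "U c \<inter> H i = G i c" if "i \<in> {1..m}" "c \<in> K" for i c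
    using that sub[of _ c] disjHH[of _ i] unfolding U_def by blast
  have fair: "fairlet P H t m (U c)" if "c \<in> K" for c
    unfolding fairlet_def
  proof (intro conjI ballI)
    show "U c \<subseteq> P" using sub[OF _ that] H_sub unfolding U_def by blast
    show "card (U c \<inter> H i) = t i" if "i \<in> {1..m}" for i
      using U_H card that \<open>c \<in> K\<close> by simp
  qed
  have U_disj: "U c \<inter> U c' = {}" if "c \<in> K" "c' \<in> K" "c \<noteq> c'" for c c'
  proof -
    have "G i c \<inter> G j c' = {}" if ij: "i \<in> {1..m}" "j \<in> {1..m}" for i j
    proof (cases "i = j")
      case True
      then show ?thesis using disj[OF ij(1)] \<open>c \<in> K\<close> \<open>c' \<in> K\<close> \<open>c \<noteq> c'\<close>
        by (simp add: disjoint_family_on_def)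
    next
      case False
      then show ?thesis using disjHH[OF ij] sub[OF ij(1) \<open>c \<in> K\<close>] sub[OF ij(2) \<open>c' \<in> K\<close>] by blast
    qed
    then show ?thesis unfolding U_def by blast
  qed
  have U_ne: "U c \<noteq> {}" if "c \<in> K" for c
    using U_H[OF one that] card[OF one that] t1 by auto
  \<comment> \<open>Equal values at different indices would be disjoint from themselves, hence
    empty.\<close>
  show "inj_on U K" using U_disj U_ne by (intro inj_onI) (metis inf.idem)
  have covered: "card (H i \<inter> \<Union>(U ` K)) = t i * L" if i: "i \<in> {1..m}" for i
  proof -
    have "H i \<inter> \<Union>(U ` K) = (\<Union>c\<in>K. G i c)" using U_H[OF i] by blast
    also have "card \<dots> = (\<Sum>c\<in>K. card (G i c))"
    proof (rule card_UN_disjoint)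
      show "\<forall>c\<in>K. finite (G i c)" using finite_subset[OF sub[OF i] finH[OF i]] by blast
      show "\<forall>c\<in>K. \<forall>c'\<in>K. c \<noteq> c' \<longrightarrow> G i c \<inter> G i c' = {}"
        using disj[OF i] unfolding disjoint_family_on_def .
    qed (rule finK)
    also have "\<dots> = t i * L" using card[OF i] K by simp
    finally show ?thesis .
  qed
  show "real (card (H i - \<Union>(U ` K))) = num_outliers H t i" if i: "i \<in> {1..m}" for i
  proof -
    have "card (H i) = card (H i \<inter> \<Union>(U ` K)) + card (H i - \<Union>(U ` K))"
      using card_Int_Diff[OF finH[OF i]] .
    then show ?thesis using covered[OF i] by (simp add: num_outliers_eq)
  qed
  \<comment> \<open>For colour 1 the covered number \<open>t 1 * L\<close> is all of
    \<open>card (H 1)\<close>. As every fairlet contains a point of \<open>H 1\<close>, no further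
    one is disjoint from all \<open>U c\<close>.\<close>
  have "H 1 \<inter> \<Union>(U ` K) = H 1"
    using covered[OF one] H1_props by (intro card_subset_eq) (auto simp: mult.commute)
  then have H1_covered: "H 1 \<subseteq> \<Union>(U ` K)" by blast
  have "\<not> (\<exists>F'. U ` K \<subset> F' \<and> (\<forall>f\<in>F'. fairlet P H t m f) \<and> disjoint F')"
  proof
    assume "\<exists>F'. U ` K \<subset> F' \<and> (\<forall>f\<in>F'. fairlet P H t m f) \<and> disjoint F'"
    then obtain F' f where F': "U ` K \<subseteq> F'" "disjoint F'" "f \<in> F'" "f \<notin> U ` K" "fairlet P H t m f"
      by blast
    have "card (f \<inter> H 1) = t 1" using F'(5) one by (simp add: fairlet_def)
    then have "f \<inter> H 1 \<noteq> {}" using t1 by auto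
    then obtain c where c: "c \<in> K" "f \<inter> U c \<noteq> {}" using H1_covered by blast
    then show False using disjointD[OF F'(2), of f "U c"] F' by blast
  qed
  moreover have "disjoint (U ` K)"
    using U_disj by (intro disjointI) blast
  ultimately show "fairlet_decomposition P H t m (U ` K)"
    using fair by (auto simp: fairlet_decomposition_def)
qed

text \<open>Guarantees that the correctness statement about all results is not vacuous.\<close>

lemma compute_fairlets_exists: "\<exists>res. compute_fairlets d H t m res"
proof -
  obtain A0 \<kappa>0 where "cap_center_solution (H 1) L (t 1) A0 \<kappa>0"
    using cap_center_solution_2OPT by blast
  from cap_center_approx_exists[OF H1_props(1,2) this, of 5 d]
  obtain A \<kappa> where A: "cap_center_approx 5 (H 1) d L (t 1) A \<kappa>" by auto
  let ?A = "Inl ` copies A" and ?d = "\<lambda>x y. d (underlying x) (underlying y)"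
  let ?P = "?A \<union> (\<Union>i\<in>{1..m}. Inr ` H i)"
  have "\<exists>res. compute_1t_fairlets ?P ?d ?A (Inr ` H i) (t i) 12 res" if "i \<in> {1..m}" for i
    using finH[OF that] finite_copies[of A] by (intro compute_1t_fairlets_exists) auto
  then obtain Fs where "\<forall>i\<in>{1..m}. compute_1t_fairlets ?P ?d ?A (Inr ` H i) (t i) 12 (Fs i)"
    by metis
  then show ?thesis using A unfolding compute_fairlets_def Let_def by blast
qed

lemma color_fairlets:
  fixes A :: "'a multiset"
  defines "A' \<equiv> Inl ` copies A" and "d' \<equiv> \<lambda>x y. d (underlying x) (underlying y)"
  assumes approx: "cap_center_approx 5 (H 1) d L (t 1) A \<kappa>" and i: "i \<in> {1..m}"
    and comp: "compute_1t_fairlets (A' \<union> (\<Union>i\<in>{1..m}. Inr ` H i)) d' A' (Inr ` H i) (t i) 12 res"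
  shows "\<exists>M. res = Some {insert r (M r) |r. r \<in> A'} \<and> disjoint_family_on M A' \<and>
    (\<forall>r\<in>A'. M r \<subseteq> Inr ` H i \<and> card (M r) = t i \<and> (\<forall>b\<in>M r. d' b r \<le> 12 * OPT))"
proof -
  obtain x y where xy: "x \<in> P" "y \<in> P" "OPT = d x y" using optimal_clustering by metis
  \<comment> \<open>\<open>Inr x\<close> and \<open>Inr y\<close> belong to the extended point set,
    so OPT is one of the thresholds tried, in the same way for every colour.\<close>
  then have OPT: "OPT = d' (Inr x) (Inr y)" by (simp add: d'_def)
  show ?thesis
    unfolding OPT
  proof (rule compute_1t_fairlets_correct[OF _ _ _ _ _ _ _ _ comp])
    show "finite (A' \<union> (\<Union>i\<in>{1..m}. Inr ` H i))"
      using finH finite_copies[of A] by (simp add: A'_def)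
    show "Inr ` H i \<subseteq> A' \<union> (\<Union>i\<in>{1..m}. Inr ` H i)" using i by blast
    show "Inr x \<in> A' \<union> (\<Union>i\<in>{1..m}. Inr ` H i)" "Inr y \<in> A' \<union> (\<Union>i\<in>{1..m}. Inr ` H i)"
      using xy(1,2) unfolding P_eq by blast+
    fix S assume "S \<subseteq> A'"
    then obtain S0 where S0: "S0 \<subseteq> copies A" "S = Inl ` S0" by (auto simp: A'_def subset_image_iff)
    \<comment> \<open>Neighbourhoods in the sum type are injective images of those among the
      original points, so Hall's condition carries over with equal cardinalities.\<close>
    have "{b\<in>Inr ` H i. d' b (Inl a) \<le> 12 * OPT} = Inr ` {b\<in>H i. d b (fst a) \<le> 12 * OPT}" for a
      by (auto simp: d'_def underlying_Inl)
    then have "(\<Union>r\<in>S. {b\<in>Inr ` H i. d' b r \<le> 12 * OPT}) =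
        Inr ` (\<Union>a\<in>S0. {b\<in>H i. d b (fst a) \<le> 12 * OPT})"
      by (simp add: S0(2) image_UN)
    then have "card (\<Union>r\<in>S. {b\<in>Inr ` H i. d' b r \<le> 12 * OPT}) =
        card (\<Union>a\<in>S0. {b\<in>H i. d b (fst a) \<le> 12 * OPT})"
      by (simp add: card_image)
    then show "t i * card S \<le> card (\<Union>r\<in>S. {b\<in>Inr ` H i. d' b r \<le> 12 * d' (Inr x) (Inr y)})"
      using hall_condition[OF approx i S0(1)] by (simp add: S0(2) card_image flip: OPT)
  qed (auto simp: A'_def)
qed

lemma compute_fairlets_correct:
  assumes "compute_fairlets d H t m res"
  shows "\<exists>F anc. res = Some {(f, anc f) |f. f \<in> F} \<and> fairlet_decomposition P H t m F \<and>
    (\<forall>i\<in>{1..m}. real (card (H i - \<Union>F)) = num_outliers H t i) \<and>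
    (\<forall>f\<in>F. Max ((\<lambda>p. d (anc f) p) ` f) \<le> 12 * OPT)"
proof -
  obtain A \<kappa> and Fs :: "nat \<Rightarrow> (('a \<times> nat) + 'a) set set option" and A' d' f' where
    approx: "cap_center_approx 5 (H 1) d L (t 1) A \<kappa>"
    and A': "A' = Inl ` copies A" and d': "d' = (\<lambda>x y. d (underlying x) (underlying y))"
    and f': "f' = (\<lambda>c. \<Union>i\<in>{1..m}. \<Union>{f \<in> the (Fs i). c \<in> f})"
    and comp: "\<And>i. i \<in> {1..m} \<Longrightarrow>
      compute_1t_fairlets (A' \<union> (\<Union>i\<in>{1..m}. Inr ` H i)) d' A' (Inr ` H i) (t i) 12 (Fs i)"
    and res: "res = (if \<exists>i\<in>{1..m}. Fs i = None then None
        else Some {(Inr -` (f' c - A'), underlying c) |c. c \<in> A'})"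
    using assms unfolding compute_fairlets_def Let_def by blast
  have "\<forall>i\<in>{1..m}. \<exists>M. Fs i = Some {insert r (M r) |r. r \<in> A'} \<and> disjoint_family_on M A' \<and>
      (\<forall>r\<in>A'. M r \<subseteq> Inr ` H i \<and> card (M r) = t i \<and> (\<forall>b\<in>M r. d' b r \<le> 12 * OPT))"
    using color_fairlets[OF approx] comp unfolding A' d' by blast
  from bchoice[OF this] obtain M where
    "\<forall>i\<in>{1..m}. Fs i = Some {insert r (M i r) |r. r \<in> A'} \<and> disjoint_family_on (M i) A' \<and>
      (\<forall>r\<in>A'. M i r \<subseteq> Inr ` H i \<and> card (M i r) = t i \<and> (\<forall>b\<in>M i r. d' b r \<le> 12 * OPT))"
    by blast
  then have Fs: "\<And>i. i \<in> {1..m} \<Longrightarrow> Fs i = Some {insert r (M i r) |r. r \<in> A'}"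
    and disj: "\<And>i. i \<in> {1..m} \<Longrightarrow> disjoint_family_on (M i) A'"
    and M: "\<And>i r. i \<in> {1..m} \<Longrightarrow> r \<in> A' \<Longrightarrow>
      M i r \<subseteq> Inr ` H i \<and> card (M i r) = t i \<and> (\<forall>b\<in>M i r. d' b r \<le> 12 * OPT)"
    by simp_all
  define U where "U c = (\<Union>i\<in>{1..m}. Inr -` M i c)" for c
  have U: "Inr -` (f' c - A') = U c" if c: "c \<in> A'" for c
  proof -
    have "\<Union>{f \<in> the (Fs i). c \<in> f} = insert c (M i c)" if i: "i \<in> {1..m}" for i
    proof -
      \<comment> \<open>Copies are \<open>Inl\<close> points and matched points are
        \<open>Inr\<close> points, so the only fairlet of colour \<open>i\<close> containing
        \<open>c\<close> is the one formed around \<open>c\<close>.\<close>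
      have "c \<notin> M i r" if "r \<in> A'" for r using M[OF i that] c by (auto simp: A')
      then have "{f \<in> the (Fs i). c \<in> f} = {insert c (M i c)}" using Fs[OF i] c by auto
      then show ?thesis by simp
    qed
    then have "f' c = (\<Union>i\<in>{1..m}. insert c (M i c))" by (simp add: f')
    then show ?thesis using c by (auto simp: U_def A')
  qed
  have "card A' = L"
    using cap_center_solution_full(1)[OF H1_props(1) _ H1_props(4) t1] approx
    by (auto simp: cap_center_approx_def A' card_image)
  moreover have "disjoint_family_on (\<lambda>c. Inr -` M i c) A'" if "i \<in> {1..m}" for i
    using disj[OF that] unfolding disjoint_family_on_def by blast
  moreover have "Inr -` M i c \<subseteq> H i" if "i \<in> {1..m}" "c \<in> A'" for i c
    using M[OF that] by auto
  moreover have "card (Inr -` M i c) = t i" if "i \<in> {1..m}" "c \<in> A'" for i c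
  proof -
    have "M i c \<subseteq> range Inr" using M[OF that] by blast
    then have "card (Inr -` M i c) = card (M i c)" by (intro card_vimage_inj) auto
    then show ?thesis using M[OF that] by simp
  qed
  ultimately have inj: "inj_on U A'" and decomp: "fairlet_decomposition P H t m (U ` A')"
    and out: "\<And>i. i \<in> {1..m} \<Longrightarrow> real (card (H i - \<Union>(U ` A'))) = num_outliers H t i"
    using decomposition_of_families[of A' "\<lambda>i c. Inr -` M i c"] unfolding U_def by blast+
  \<comment> \<open>The algorithm attaches anchors to copies; injectivity of \<open>U\<close>
    recovers the copy from its fairlet, even when several copies share an underlying point.\<close>
  define anc where "anc f = underlying (the_inv_into A' U f)" for f
  have anc: "anc (U c) = underlying c" if "c \<in> A'" for c
    using inj that by (simp add: anc_def the_inv_into_f_f)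
  have "{(Inr -` (f' c - A'), underlying c) |c. c \<in> A'} = {(f, anc f) |f. f \<in> U ` A'}"
    using U anc by force
  moreover have "\<forall>i\<in>{1..m}. Fs i \<noteq> None" using Fs by simp
  ultimately have "res = Some {(f, anc f) |f. f \<in> U ` A'}" using res by auto
  moreover have "Max ((\<lambda>p. d (anc f) p) ` f) \<le> 12 * OPT" if f: "f \<in> U ` A'" for f
  proof -
    obtain c where c: "c \<in> A'" "f = U c" using f by blast
    have fair: "fairlet P H t m f" using decomp f by (auto simp: fairlet_decomposition_def)
    then have "finite f" using finP finite_subset by (auto simp: fairlet_def)
    \<comment> \<open>With finiteness, this reduces the bound on \<open>Max\<close> to a bound for
      each point of \<open>f\<close>.\<close>
    moreover have "f \<noteq> {}" using fair t1 m by (fastforce simp: fairlet_def)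
    moreover have "d (anc f) p \<le> 12 * OPT" if "p \<in> f" for p
    proof -
      obtain i where i: "i \<in> {1..m}" "Inr p \<in> M i c" using \<open>p \<in> f\<close> unfolding c(2) U_def by blast
      then have "d' (Inr p) c \<le> 12 * OPT" using M[OF i(1) c(1)] by blast
      then show ?thesis using anc c by (simp add: d' commute)
    qed
    ultimately show ?thesis by simp
  qed
  ultimately show ?thesis using decomp out by (intro exI[of _ "U ` A'"] exI[of _ anc]) blast
qed

end

theorem lemmaD5:
  fixes P :: "'a set" and d :: "'a \<Rightarrow> 'a \<Rightarrow> real"
    and H :: "nat \<Rightarrow> 'a set" and t :: "nat \<Rightarrow> nat" and m k :: nat
  assumes "Metric_space P d" and "finite P"
    and "m \<ge> 1"
    and "P = (\<Union>i\<in>{1..m}. H i)" and "disjoint_family_on H {1..m}"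
    and "\<forall>i\<in>{1..m}. t i > 0" and "Gcd (t ` {1..m}) = 1"
    and "card (H 1) > 0" and "t 1 dvd card (H 1)"
    and "\<forall>i\<in>{2..m}. real (card (H i)) \<ge> real (t i) / real (t 1) * real (card (H 1))"
    and "k \<ge> 1"
  shows "(\<exists>res. compute_fairlets d H t m res) \<and>
    (\<forall>res. compute_fairlets d H t m res \<longrightarrow>
       (\<exists>F anc. res = Some {(f, anc f) |f. f \<in> F} \<and>
          fairlet_decomposition P H t m F \<and>
          (\<forall>i\<in>{2..m}. real (card (H i - \<Union>F)) = num_outliers H t i) \<and>
          (\<forall>f\<in>F. Max ((\<lambda>p. d (anc f) p) ` f) \<le> 12 * OPT_fair P d H t m k)))"
proof -
  have "fair_instance_axioms P H t m k"
    using assms(2-) unfolding fair_instance_axioms_def by (intro conjI) simp_all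
  with assms(1) interpret fair_instance P d H t m k by (rule fair_instance.intro)
  show ?thesis
  proof (intro conjI allI impI)
    show "\<exists>res. compute_fairlets d H t m res" by (rule compute_fairlets_exists)
    fix res assume "compute_fairlets d H t m res"
    from compute_fairlets_correct[OF this] obtain F anc where
      "res = Some {(f, anc f) |f. f \<in> F}" "fairlet_decomposition P H t m F"
      "\<forall>f\<in>F. Max ((\<lambda>p. d (anc f) p) ` f) \<le> 12 * OPT_fair P d H t m k"
      and out: "\<forall>i\<in>{1..m}. real (card (H i - \<Union>F)) = num_outliers H t i"
      by (elim exE conjE)
    moreover from out have "\<forall>i\<in>{2..m}. real (card (H i - \<Union>F)) = num_outliers H t i" by simp
    ultimately show "\<exists>F anc. res = Some {(f, anc f) |f. f \<in> F} \<and>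
          fairlet_decomposition P H t m F \<and>
          (\<forall>i\<in>{2..m}. real (card (H i - \<Union>F)) = num_outliers H t i) \<and>
          (\<forall>f\<in>F. Max ((\<lambda>p. d (anc f) p) ` f) \<le> 12 * OPT_fair P d H t m k)"
      by (intro exI conjI)
  qed
qed

end
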